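(* Let $f(\theta)=a_0+\sum_{n=1}^N(a_n\cos n\theta+b_n\sin n\theta)$, $\theta\in\mathbb R$, be a trigonometric polynomial, and let $\boldsymbol\theta=(\theta_1,\ldots,\theta_{M+1})^{\mathsf T}$, $M\ge 2$, be a grid $-\pi=\theta_1<\cdots<\theta_{M+1}=\pi$. For $b\in\{-1,0\}$ we can write $f(\theta)=\mathbf P^{(b),\boldsymbol\theta}(\theta)\,\mathbf f^{(b),\boldsymbol\theta}$, where $\mathbf f^{(b),\boldsymbol\theta}=\big([\mathbf f_0^{(b),\boldsymbol\theta}]^{\mathsf T},\mathbf 0^{\mathsf T}\big)^{\mathsf T}$ with $\mathbf f_0^{(0),\boldsymbol\theta}\in\mathbb R^{M(2N+1)}$ and $\mathbf f_0^{(-1),\boldsymbol\theta}\in\mathbb R^{M\max\{2N,1\}}$.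
   Context: Semiclassical Jacobi polynomials: for $t>1$, $a,b>-1$, $c\in\mathbb R$, $P_n^{t,(a,b,c)}$ ($n\ge0$, degree exactly $n$) are the orthogonal polynomials on $[0,1]$ with weight $x^a(1-x)^b(t-x)^c$, normalised so that $P_0=1$ and all have the same norm as $1$. For $b=-1$: $P_0^{t,(a,-1,c)}=1$ and $P_n^{t,(a,-1,c)}(x)=(1-x)P_{n-1}^{t,(a,1,c)}(x)$, $n\ge1$. Arc polynomials: for $|h|<1$, $b\ge-1$, $\tau=2/(1-h)$, $\sigma=(\cos\theta-1)/(h-1)$: $p_n^{(b,h)}(\theta)=P_n^{\tau,(-1/2,b,-1/2)}(\sigma)$ ($n\ge0$), $q_n^{(b,h)}(\theta)=\sin\theta\,P_{n-1}^{\tau,(1/2,b,1/2)}(\sigma)$ ($n\ge1$). Piecewise bases: put $E_i=[\theta_i,\theta_{i+1}]$, $\ell_i=\theta_{i+1}-\theta_i$, $\varphi_i=\ell_i/2$, $h_i=\cos\varphi_i$, $a_i(\theta)=\theta-(\theta_i+\theta_{i+1})/2$ for $i=1,\ldots,M$, with index $0$ identified with $M$. Set $P_{m1;i}^{(b),\boldsymbol\theta}(\theta)=q_m^{(b,h_i)}(a_i(\theta))$ ($m\ge1$) and $P_{m2;i}^{(b),\boldsymbol\theta}(\theta)=p_m^{(b,h_i)}(a_i(\theta))$ ($m\ge0$) on $E_i$, and $0$ elsewhere; $\mathbf P_{mj}^{(b),\boldsymbol\theta}=[P_{mj;1}^{(b),\boldsymbol\theta}\ \cdots\ P_{mj;M}^{(b),\boldsymbol\theta}]$.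 Then $\mathbf P^{(0),\boldsymbol\theta}=[\mathbf P_{02}^{(0),\boldsymbol\theta}\ \mathbf P_{11}^{(0),\boldsymbol\theta}\ \mathbf P_{12}^{(0),\boldsymbol\theta}\ \mathbf P_{21}^{(0),\boldsymbol\theta}\ \mathbf P_{22}^{(0),\boldsymbol\theta}\cdots]$ and $\mathbf P^{(-1),\boldsymbol\theta}=[\phi_1\cdots\phi_M\ \ \mathbf P_{12}^{(-1),\boldsymbol\theta}\ \mathbf P_{21}^{(-1),\boldsymbol\theta}\ \mathbf P_{22}^{(-1),\boldsymbol\theta}\ \mathbf P_{31}^{(-1),\boldsymbol\theta}\cdots]$, where $\phi_i$ is the hat function equal to $\tfrac12\big(1+\sin a_{i-1}(\theta)/\sin\varphi_{i-1}\big)$ on $E_{i-1}$, $\tfrac12\big(1-\sin a_i(\theta)/\sin\varphi_i\big)$ on $E_i$ and $0$ elsewhere ($E_0=E_M$). Functions are considered on $[-\pi,\pi]$ and extended $2\pi$-periodically; for the (discontinuous) $b=0$ basis, identities are understood on the interiors of the elements. *)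

theory Defs
  imports "HOL-Analysis.Analysis" "HOL-Computational_Algebra.Polynomial"
begin

definition sj_weight :: "real \<Rightarrow> real \<Rightarrow> real \<Rightarrow> real \<Rightarrow> real \<Rightarrow> real" where
  "sj_weight t a b c x = x powr a * (1 - x) powr b * (t - x) powr c"

definition sj_inner :: "real \<Rightarrow> real \<Rightarrow> real \<Rightarrow> real \<Rightarrow> real poly \<Rightarrow> real poly \<Rightarrow> real" where
  "sj_inner t a b c p q = (LBINT x:{0..1}. poly p x * poly q x * sj_weight t a b c x)"

text \<open>Orthogonality and the norm condition determine each member only up to sign; the sign is
  fixed by the usual convention of a positive leading coefficient.\<close>

definition is_semiclassical_jacobi ::
  "real \<Rightarrow> real \<Rightarrow> real \<Rightarrow> real \<Rightarrow> (nat \<Rightarrow> real poly) \<Rightarrow> bool" where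
  "is_semiclassical_jacobi t a b c P \<longleftrightarrow>
     P 0 = 1 \<and>
     (\<forall>n. degree (P n) = n \<and> lead_coeff (P n) > 0) \<and>
     (\<forall>m n. m \<noteq> n \<longrightarrow> sj_inner t a b c (P m) (P n) = 0) \<and>
     (\<forall>n. sj_inner t a b c (P n) (P n) = sj_inner t a b c 1 1)"

text \<open>Meaningful for \<open>t > 1\<close>, \<open>a > -1\<close> and \<open>b \<ge> -1\<close>. For \<open>b = -1\<close> the weight is not
  integrable and the family is defined from the one with \<open>b = 1\<close>.\<close>

definition semiclassical_jacobi ::
  "real \<Rightarrow> real \<Rightarrow> real \<Rightarrow> real \<Rightarrow> nat \<Rightarrow> real poly" where
  "semiclassical_jacobi t a b c n =
     (if b = -1 then
        (if n = 0 then 1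
         else [:1, -1:] * (THE P. is_semiclassical_jacobi t a 1 c P) (n - 1))
      else (THE P. is_semiclassical_jacobi t a b c P) n)"

definition arc_tau :: "real \<Rightarrow> real" where
  "arc_tau h = 2 / (1 - h)"

definition arc_sigma :: "real \<Rightarrow> real \<Rightarrow> real" where
  "arc_sigma h \<theta> = (cos \<theta> - 1) / (h - 1)"

definition arc_p :: "real \<Rightarrow> real \<Rightarrow> nat \<Rightarrow> real \<Rightarrow> real" where
  "arc_p b h n \<theta> =
     poly (semiclassical_jacobi (arc_tau h) (-1/2) b (-1/2) n) (arc_sigma h \<theta>)"

text \<open>Only used for \<open>n \<ge> 1\<close>.\<close>

definition arc_q :: "real \<Rightarrow> real \<Rightarrow> nat \<Rightarrow> real \<Rightarrow> real" where
  "arc_q b h n \<theta> =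
     sin \<theta> * poly (semiclassical_jacobi (arc_tau h) (1/2) b (1/2) (n - 1)) (arc_sigma h \<theta>)"

text \<open>A grid is a function \<open>g\<close> of which only the values \<open>g 1, \<dots>, g (M + 1)\<close> matter; elements are
  numbered \<open>1, \<dots>, M\<close>.\<close>

definition elem :: "(nat \<Rightarrow> real) \<Rightarrow> nat \<Rightarrow> real set" where
  "elem g i = {g i..g (i + 1)}"

definition half_len :: "(nat \<Rightarrow> real) \<Rightarrow> nat \<Rightarrow> real" where
  "half_len g i = (g (i + 1) - g i) / 2"

definition centred :: "(nat \<Rightarrow> real) \<Rightarrow> nat \<Rightarrow> real \<Rightarrow> real" where
  "centred g i \<theta> = \<theta> - (g i + g (i + 1)) / 2"

definition pw_sin :: "real \<Rightarrow> (nat \<Rightarrow> real) \<Rightarrow> nat \<Rightarrow> nat \<Rightarrow> real \<Rightarrow> real" where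
  "pw_sin b g m i \<theta> =
     (if \<theta> \<in> elem g i then arc_q b (cos (half_len g i)) m (centred g i \<theta>) else 0)"

definition pw_cos :: "real \<Rightarrow> (nat \<Rightarrow> real) \<Rightarrow> nat \<Rightarrow> nat \<Rightarrow> real \<Rightarrow> real" where
  "pw_cos b g m i \<theta> =
     (if \<theta> \<in> elem g i then arc_p b (cos (half_len g i)) m (centred g i \<theta>) else 0)"

definition prev_elem :: "nat \<Rightarrow> nat \<Rightarrow> nat" where
  "prev_elem M i = (if i = 1 then M else i - 1)"

text \<open>For \<open>M \<ge> 2\<close> the two elements meet in nodes only, where both formulas agree.\<close>

definition hat :: "nat \<Rightarrow> (nat \<Rightarrow> real) \<Rightarrow> nat \<Rightarrow> real \<Rightarrow> real" where
  "hat M g i \<theta> =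
     (let k = prev_elem M i in
      if \<theta> \<in> elem g k then (1 + sin (centred g k \<theta>) / sin (half_len g k)) / 2
      else if \<theta> \<in> elem g i then (1 - sin (centred g i \<theta>) / sin (half_len g i)) / 2
      else 0)"

text \<open>Translates the argument by a multiple of \<open>2\<pi>\<close> into \<open>[-\<pi>, \<pi>)\<close>.\<close>

definition periodic_ext :: "(real \<Rightarrow> real) \<Rightarrow> real \<Rightarrow> real" where
  "periodic_ext u \<theta> = u (\<theta> - 2 * pi * of_int \<lfloor>(\<theta> + pi) / (2 * pi)\<rfloor>)"

text \<open>Columns of the quasimatrices, counted from 0. They come in blocks of \<open>M\<close>, one column per
  element: column \<open>k\<close> is in block \<open>k div M\<close> and belongs to element \<open>k mod M + 1\<close>. In terms of the
  pairs \<open>(m, j)\<close>, with \<open>j = 1\<close> for \<^const>\<open>pw_sin\<close> and \<open>j = 2\<close> for \<^const>\<open>pw_cos\<close>, the block order is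
  \<open>02, 11, 12, 21, 22, \<dots>\<close> for \<open>b = 0\<close> and \<open>hats, 12, 21, 22, 31, \<dots>\<close> for \<open>b = -1\<close>.\<close>

definition basis_zero :: "nat \<Rightarrow> (nat \<Rightarrow> real) \<Rightarrow> nat \<Rightarrow> real \<Rightarrow> real" where
  "basis_zero M g k =
     (let r = k div M; i = k mod M + 1 in
      periodic_ext
        (if even r then pw_cos 0 g (r div 2) i else pw_sin 0 g ((r + 1) div 2) i))"

definition basis_minus_one :: "nat \<Rightarrow> (nat \<Rightarrow> real) \<Rightarrow> nat \<Rightarrow> real \<Rightarrow> real" where
  "basis_minus_one M g k =
     (let r = k div M; i = k mod M + 1 in
      periodic_ext
        (if r = 0 then hat M g i
         else if odd r then pw_cos (-1) g ((r + 1) div 2) i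
         else pw_sin (-1) g (r div 2 + 1) i))"

definition zero_padded :: "real list \<Rightarrow> nat \<Rightarrow> real" where
  "zero_padded v k = (if k < length v then v ! k else 0)"

end

theory Submission
  imports Defs
begin

text \<open>Centred on an element of half-length \<open>\<phi>\<close>, a trigonometric polynomial of degree \<open>N\<close> is
  \<open>A(\<sigma>) + sin x B(\<sigma>)\<close> with polynomials \<open>deg A \<le> N\<close>, \<open>deg B \<le> N - 1\<close>, since \<open>cos x\<close> is an affine
  function of \<open>\<sigma>\<close>. For \<open>b = 0\<close> one expands \<open>A\<close> and \<open>B\<close> in the two orthogonal families, which are
  graded bases by Gram-Schmidt. For \<open>b = -1\<close> one first splits off \<open>A(1) + sin x B(1)\<close>: this is the
  combination of the two local hats that interpolates the end point values, because \<open>\<sigma> = 1\<close> at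
  \<open>x = \<plusminus>\<phi>\<close>. The remainders are divisible by \<open>1 - \<sigma>\<close>, lose one degree and vanish at the nodes;
  the end point values of neighbouring elements agree by continuity and periodicity.\<close>

section \<open>Graded polynomial bases and Gram-Schmidt for an abstract inner product\<close>

lemma poly_graded_expansion:
  fixes B :: "nat \<Rightarrow> 'a :: field poly"
  assumes deg: "\<And>k. degree (B k) = k" and nz: "\<And>k. B k \<noteq> 0"
    and p: "\<And>k. k \<ge> n \<Longrightarrow> coeff p k = 0"
  shows "\<exists>c. p = (\<Sum>k<n. smult (c k) (B k))"
  using p
proof (induction n arbitrary: p)
  case 0
  then have "p = 0" by (auto simp: poly_eq_iff)
  then show ?case by simp
next
  case (Suc n)
  define d where "d = coeff p n / coeff (B n) n"
  have lc: "coeff (B n) n \<noteq> 0" using deg[of n] nz[of n] by (metis leading_coeff_0_iff)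
  have "coeff (p - smult d (B n)) k = 0" if "k \<ge> n" for k
  proof (cases "k = n")
    case True
    then show ?thesis using lc by (simp add: d_def)
  next
    case False
    then have "k \<ge> Suc n" "degree (B n) < k" using that deg[of n] by auto
    then show ?thesis using Suc.prems[of k] by (simp add: coeff_eq_0)
  qed
  from Suc.IH[OF this] obtain c where "p - smult d (B n) = (\<Sum>k<n. smult (c k) (B k))" by blast
  then have "p = (\<Sum>k<n. smult (c k) (B k)) + smult d (B n)" by (simp add: algebra_simps)
  also have "\<dots> = (\<Sum>k<Suc n. smult ((c(n := d)) k) (B k))" by simp
  finally show ?case by blast
qed

locale poly_inner_product =
  fixes I :: "real poly \<Rightarrow> real poly \<Rightarrow> real"
  assumes sym: "I p q = I q p"
    and add_right: "I p (q + r) = I p q + I p r"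
    and scale_right: "I p (smult c q) = c * I p q"
    and pos: "p \<noteq> 0 \<Longrightarrow> I p p > 0"
begin

lemma zero_right [simp]: "I p 0 = 0"
  using scale_right[of p 0 0] by simp

lemma minus_right: "I p (q - r) = I p q - I p r"
  using add_right[of p q "smult (-1) r"] scale_right[of p "-1" r] by simp

lemma sum_right: "I p (\<Sum>k\<in>A. h k) = (\<Sum>k\<in>A. I p (h k))"
  by (induction A rule: infinite_finite_induct) (simp_all add: add_right)

lemma scale_left: "I (smult c p) q = c * I p q"
  using scale_right sym by metis

text \<open>Mirrors \<open>is_semiclassical_jacobi\<close> clause by clause with the integral
  replaced by \<open>I\<close>, so the two predicates coincide once \<open>I\<close> is
  \<open>sj_inner\<close>.\<close>

definition orthogonal_family :: "(nat \<Rightarrow> real poly) \<Rightarrow> bool" where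
  "orthogonal_family P \<longleftrightarrow>
     P 0 = 1 \<and>
     (\<forall>n. degree (P n) = n \<and> lead_coeff (P n) > 0) \<and>
     (\<forall>m n. m \<noteq> n \<longrightarrow> I (P m) (P n) = 0) \<and>
     (\<forall>n. I (P n) (P n) = I 1 1)"

function gram_schmidt :: "nat \<Rightarrow> real poly" where
  "gram_schmidt n = monom 1 n -
     (\<Sum>k<n. smult (I (monom 1 n) (gram_schmidt k) / I (gram_schmidt k) (gram_schmidt k))
                   (gram_schmidt k))"
  by auto
termination by (relation "Wellfounded.measure id") auto

declare gram_schmidt.simps [simp del]

text \<open>The terms subtracted from the monomial have smaller degree by induction, so the leading
  monomial survives.\<close>

lemma gram_schmidt_coeff:
  "coeff (gram_schmidt n) n = 1 \<and> (\<forall>j>n. coeff (gram_schmidt n) j = 0)"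
proof (induction n rule: less_induct)
  case (less n)
  have "coeff (gram_schmidt n) j = coeff (monom 1 n) j" if "j \<ge> n" for j
    using less that by (subst gram_schmidt.simps) (auto simp: coeff_sum)
  then show ?case by simp
qed

lemma degree_gram_schmidt: "degree (gram_schmidt n) = n"
  using gram_schmidt_coeff[of n] by (intro antisym degree_le le_degree) auto

lemma gram_schmidt_nz: "gram_schmidt n \<noteq> 0"
  using gram_schmidt_coeff[of n] by auto

text \<open>Earlier members are mutually orthogonal by strong induction, so only the projection with
  \<open>k = j\<close> survives in the sum, and it cancels the product with the monomial.\<close>

lemma gram_schmidt_orth_less: "j < n \<Longrightarrow> I (gram_schmidt n) (gram_schmidt j) = 0"
proof (induction n arbitrary: j rule: less_induct)
  case (less n)
  have orth: "I (gram_schmidt j) (gram_schmidt k) = 0" if "k < n" "k \<noteq> j" for k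
    using less that sym by (metis linorder_neqE_nat)
  let ?c = "\<lambda>k. I (monom 1 n) (gram_schmidt k) / I (gram_schmidt k) (gram_schmidt k)"
  have "I (gram_schmidt j) (gram_schmidt n) =
      I (gram_schmidt j) (monom 1 n) - (\<Sum>k<n. ?c k * I (gram_schmidt j) (gram_schmidt k))"
    by (subst gram_schmidt.simps[of n]) (simp add: minus_right sum_right scale_right)
  also have "(\<Sum>k<n. ?c k * I (gram_schmidt j) (gram_schmidt k)) =
      (\<Sum>k<n. if k = j then I (monom 1 n) (gram_schmidt j) else 0)"
    using orth pos[OF gram_schmidt_nz, of j] by (intro sum.cong) auto
  also have "\<dots> = I (gram_schmidt j) (monom 1 n)"
    using less.prems sym by simp
  finally show ?case using sym by simp
qed

lemma gram_schmidt_orth: "m \<noteq> n \<Longrightarrow> I (gram_schmidt m) (gram_schmidt n) = 0"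
  using gram_schmidt_orth_less sym by (metis linorder_neqE_nat)

lemma orthogonal_family_exists: "\<exists>P. orthogonal_family P"
proof -
  \<comment> \<open>Rescaling by \<open>s n\<close> gives each member the norm of 1. The factor is
    positive, which keeps the sign of the leading coefficient, and \<open>s 0 = 1\<close> keeps
    \<open>P 0 = 1\<close>.\<close>
  define s where "s n = sqrt (I 1 1 / I (gram_schmidt n) (gram_schmidt n))" for n
  have s: "s n > 0" "(s n)\<^sup>2 * I (gram_schmidt n) (gram_schmidt n) = I 1 1" for n
    using pos[of 1] pos[OF gram_schmidt_nz, of n] by (auto simp: s_def)
  have gs0: "gram_schmidt 0 = 1" by (subst gram_schmidt.simps) simp
  have "s 0 = 1" using pos[of 1] by (simp add: s_def gs0)
  then have "orthogonal_family (\<lambda>n. smult (s n) (gram_schmidt n))"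
    using s less_imp_neq[OF s(1)]
    by (auto simp: orthogonal_family_def gs0 degree_gram_schmidt scale_left scale_right
        gram_schmidt_orth gram_schmidt_coeff power2_eq_square mult.assoc)
  then show ?thesis by blast
qed

text \<open>The members of index below \<open>n\<close> already span all polynomials of degree below
  \<open>n\<close>, and \<open>P n\<close> is orthogonal to each of them.\<close>

lemma orthogonal_family_orth_lower:
  assumes P: "orthogonal_family P" and q: "\<And>k. k \<ge> n \<Longrightarrow> coeff q k = 0"
  shows "I (P n) q = 0"
proof -
  have "degree (P k) = k" "P k \<noteq> 0" for k
    using P by (auto simp: orthogonal_family_def dest!: spec[of _ k])
  from poly_graded_expansion[OF this q] obtain c where "q = (\<Sum>k<n. smult (c k) (P k))"
    by blast
  then show ?thesis using P by (simp add: sum_right scale_right orthogonal_family_def)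
qed

text \<open>Once leading coefficients are matched, the difference \<open>r\<close> has lower degree,
  hence is orthogonal to \<open>P n\<close> and \<open>Q n\<close> and so to itself. Equal norms and
  positive leading coefficients then force the ratio \<open>s\<close> to be 1.\<close>

lemma orthogonal_family_unique:
  assumes P: "orthogonal_family P" and Q: "orthogonal_family Q"
  shows "P = Q"
proof
  fix n
  have lc: "coeff (P n) n > 0" "coeff (Q n) n > 0" and
    deg: "degree (P n) = n" "degree (Q n) = n"
    using P Q unfolding orthogonal_family_def by metis+
  define s where "s = coeff (P n) n / coeff (Q n) n"
  define r where "r = P n - smult s (Q n)"
  have "s > 0" using lc by (simp add: s_def)
  have low: "coeff r k = 0" if "k \<ge> n" for k
    using that lc deg by (cases "k = n") (auto simp: r_def s_def coeff_eq_0)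
  have "I r r = I r (P n) - s * I r (Q n)" by (subst (2) r_def) (simp add: minus_right scale_right)
  also have "\<dots> = 0"
    using orthogonal_family_orth_lower[OF P low] orthogonal_family_orth_lower[OF Q low] sym
    by simp
  finally have "r = 0" using pos[of r] by auto
  then have PQ: "P n = smult s (Q n)" by (simp add: r_def)
  have "I (P n) (P n) = s * s * I (Q n) (Q n)" by (simp add: PQ scale_left scale_right)
  moreover have "I (P n) (P n) = I 1 1" "I (Q n) (Q n) = I 1 1"
    using P Q by (simp_all add: orthogonal_family_def)
  ultimately have "s * s = 1" using pos[of 1] by simp
  then have "s = 1" using \<open>s > 0\<close> by (simp add: square_eq_1_iff)
  then show "P n = Q n" by (simp add: PQ)
qed

end

section \<open>The weighted inner product and the semiclassical Jacobi families\<close>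

lemma sj_weight_integrable:
  assumes "t > 1" "a > -1" "b \<ge> 0"
  shows "set_integrable lborel {0..1} (\<lambda>x. poly r x * sj_weight t a b c x)"
proof -
  \<comment> \<open>The integrable majorant is \<open>K * x powr a\<close>: the factor
    \<open>(t - x) powr c\<close> is continuous because \<open>t > 1\<close>, and
    \<open>(1 - x) powr b\<close> is at most 1 because \<open>b >= 0\<close>.\<close>
  have "compact ((\<lambda>x. poly r x * (t - x) powr c) ` {0..1})"
    using assms(1) by (intro compact_continuous_image continuous_intros) auto
  then obtain K where K: "\<And>x. x \<in> {0..1} \<Longrightarrow> \<bar>poly r x * (t - x) powr c\<bar> \<le> K"
    using compact_imp_bounded by (force simp: bounded_iff)
  \<comment> \<open>The power is known to be gauge integrable; nonnegativity makes it Lebesgue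
    integrable, and Borel measurability allows the passage from \<open>lebesgue\<close> to
    \<open>lborel\<close>.\<close>
  have "set_integrable lebesgue {0..1::real} (\<lambda>x. x powr a)"
    using assms(2) by (intro nonnegative_absolutely_integrable_1 integrable_on_powr_from_0) auto
  then have "set_integrable lborel {0..1::real} (\<lambda>x. x powr a)"
    unfolding set_integrable_def by (subst (asm) integrable_completion) auto
  then have "set_integrable lborel {0..1::real} (\<lambda>x. K * x powr a)"
    by (intro set_integrable_mult_right) auto
  then show ?thesis
  proof (rule set_integrable_bound)
    show "set_borel_measurable lborel {0..1} (\<lambda>x. poly r x * sj_weight t a b c x)"
    proof -
      have [measurable]: "poly r \<in> borel_measurable borel"
        by (intro borel_measurable_continuous_onI continuous_intros)
      show ?thesis unfolding set_borel_measurable_def sj_weight_def by measurable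
    qed
    show "AE x in lborel. x \<in> {0..1} \<longrightarrow>
        norm (poly r x * sj_weight t a b c x) \<le> norm (K * x powr a)"
    proof (intro AE_I2 impI)
      fix x :: real assume x: "x \<in> {0..1}"
      have "norm (poly r x * sj_weight t a b c x) =
          \<bar>poly r x * (t - x) powr c\<bar> * (1 - x) powr b * x powr a"
        by (simp add: sj_weight_def abs_mult)
      also have "\<dots> \<le> K * 1 * x powr a"
        using K[OF x] x assms(3) by (intro mult_mono powr_le1) auto
      finally show "norm (poly r x * sj_weight t a b c x) \<le> norm (K * x powr a)"
        by simp
    qed
  qed
qed

text \<open>A nonnegative integrand with integral 0 vanishes almost everywhere. The weight is
  positive on the open interval and \<open>p\<close> has finitely many roots, so that interval would
  be a null set.\<close>

lemma sj_inner_pos: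
  assumes "t > 1" "a > -1" "b \<ge> 0" and "p \<noteq> 0"
  shows "sj_inner t a b c p p > 0"
proof (rule ccontr)
  let ?F = "\<lambda>x. indicator {0..1} x *\<^sub>R (poly p x * poly p x * sj_weight t a b c x)"
  assume "\<not> sj_inner t a b c p p > 0"
  moreover have nonneg: "?F x \<ge> 0" for x by (simp add: sj_weight_def)
  then have "sj_inner t a b c p p \<ge> 0"
    unfolding sj_inner_def set_lebesgue_integral_def by (intro Bochner_Integration.integral_nonneg)
  moreover have "integrable lborel ?F"
    using sj_weight_integrable[OF assms(1-3), of "p * p"] by (simp add: set_integrable_def)
  ultimately have "AE x in lborel. ?F x = 0"
    using nonneg unfolding sj_inner_def set_lebesgue_integral_def
    by (subst integral_nonneg_eq_0_iff_AE[symmetric]) auto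
  moreover have "AE x in lborel. x \<notin> {x. poly p x = 0}"
    using poly_roots_finite[OF assms(4)] by (intro AE_not_in finite_imp_null_set_lborel)
  ultimately have "AE x in lborel. x \<notin> {0<..<1::real}"
    by eventually_elim (use assms(1) in \<open>auto simp: sj_weight_def\<close>)
  then have "{0<..<1::real} \<in> null_sets lborel"
    by (subst (asm) AE_iff_null_sets[symmetric]) auto
  then show False by (simp add: null_sets_def)
qed

lemma sj_inner_poly_inner_product:
  assumes "t > 1" "a > -1" "b \<ge> 0"
  shows "poly_inner_product (sj_inner t a b c)"
proof
  fix p q r :: "real poly" and s :: real
  show "sj_inner t a b c p q = sj_inner t a b c q p"
    by (simp add: sj_inner_def mult.commute)
  show "sj_inner t a b c p (q + r) = sj_inner t a b c p q + sj_inner t a b c p r"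
    unfolding sj_inner_def
    using sj_weight_integrable[OF assms, of "p * q"] sj_weight_integrable[OF assms, of "p * r"]
    by (subst set_integral_add(2)[symmetric]) (simp_all add: algebra_simps)
  show "sj_inner t a b c p (smult s q) = s * sj_inner t a b c p q"
    unfolding sj_inner_def by (subst set_integral_mult_right[symmetric]) (simp add: mult_ac)
  show "p \<noteq> 0 \<Longrightarrow> sj_inner t a b c p p > 0"
    by (rule sj_inner_pos[OF assms])
qed

text \<open>Existence and uniqueness give meaning to the description operator. The range
  \<open>b >= 0\<close> contains the values 0 and 1, and the family for \<open>b = -1\<close> is
  built from the one for 1.\<close>

lemma is_semiclassical_jacobi_The:
  assumes "t > 1" "a > -1" "b \<ge> 0"
  shows "is_semiclassical_jacobi t a b c (THE P. is_semiclassical_jacobi t a b c P)"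
proof -
  interpret poly_inner_product "sj_inner t a b c"
    by (rule sj_inner_poly_inner_product[OF assms])
  have eq: "is_semiclassical_jacobi t a b c = orthogonal_family"
    by (intro ext) (simp add: is_semiclassical_jacobi_def orthogonal_family_def)
  show ?thesis unfolding eq
    using orthogonal_family_exists orthogonal_family_unique by (metis theI)
qed

lemma semiclassical_jacobi_expansion:
  assumes "t > 1" "a > -1" "b \<ge> 0" and p: "\<forall>k\<ge>n. coeff p k = 0"
  shows "\<exists>u. p = (\<Sum>k<n. smult (u k) ((THE P. is_semiclassical_jacobi t a b c P) k))"
proof (rule poly_graded_expansion)
  show "\<And>k. k \<ge> n \<Longrightarrow> coeff p k = 0" using p by blast
  fix k
  show "degree ((THE P. is_semiclassical_jacobi t a b c P) k) = k"
    using is_semiclassical_jacobi_The[OF assms(1-3)] by (simp add: is_semiclassical_jacobi_def)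
  show "(THE P. is_semiclassical_jacobi t a b c P) k \<noteq> 0"
    using is_semiclassical_jacobi_The[OF assms(1-3), of c]
    by (auto simp: is_semiclassical_jacobi_def dest!: spec[of _ k])
qed

section \<open>Chebyshev polynomials in an affine variable and shifted trigonometric
  polynomials\<close>

lemma cos_sin_multiple_poly:
  fixes L :: "real poly"
  assumes "degree L \<le> 1"
  shows "\<exists>T. degree T \<le> n \<and> (\<forall>x y. cos x = poly L y \<longrightarrow> cos (real n * x) = poly T y)"
    and "\<exists>U. degree U \<le> n \<and> (\<forall>x y. cos x = poly L y \<longrightarrow> sin (real (Suc n) * x) = sin x * poly U y)"
proof -
  \<comment> \<open>The witnesses are the Chebyshev polynomials of both kinds composed with
    \<open>L\<close>; their three-term recurrence raises the degree by at most one because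
    \<open>L\<close> is affine.\<close>
  have step: "degree (2 * L * p - q) \<le> Suc (Suc n)"
    if "degree p \<le> Suc n" "degree q \<le> n" for p q :: "real poly" and n
  proof (rule degree_diff_le)
    have "degree (2 * L * p) = degree (smult 2 (L * p))" by (simp add: numeral_poly mult.assoc)
    also have "\<dots> \<le> Suc (Suc n)"
      using degree_mult_le[of L p] assms that(1) by (auto intro: order_trans)
    finally show "degree (2 * L * p) \<le> Suc (Suc n)" .
  qed (use that in simp)
  let ?C = "\<lambda>n T. degree T \<le> n \<and> (\<forall>x y. cos x = poly L y \<longrightarrow> cos (real n * x) = poly T y)"
  let ?S = "\<lambda>n U. degree U \<le> n \<and>
      (\<forall>x y. cos x = poly L y \<longrightarrow> sin (real (Suc n) * x) = sin x * poly U y)"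
  have cos_step: "cos (real (Suc (Suc n)) * x) = 2 * cos x * cos (real (Suc n) * x) - cos (real n * x)"
    and sin_step: "sin (real (Suc (Suc n)) * x) = 2 * cos x * sin (real (Suc n) * x) - sin (real n * x)"
    for n x
  proof -
    have e: "real (Suc (Suc n)) * x = real (Suc n) * x + x" "real n * x = real (Suc n) * x - x"
      by (simp_all add: algebra_simps)
    show "cos (real (Suc (Suc n)) * x) = 2 * cos x * cos (real (Suc n) * x) - cos (real n * x)"
      unfolding e by (simp only: cos_add cos_diff) simp
    show "sin (real (Suc (Suc n)) * x) = 2 * cos x * sin (real (Suc n) * x) - sin (real n * x)"
      unfolding e by (simp only: sin_add sin_diff) simp
  qed
  \<comment> \<open>Two consecutive members are carried through the induction, as the recurrence
    looks back two steps.\<close>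
  have C: "(\<exists>T. ?C n T) \<and> (\<exists>T. ?C (Suc n) T)"
  proof (induction n)
    case 0
    have "?C 0 1" "?C (Suc 0) L" using assms by auto
    then show ?case by blast
  next
    case (Suc n)
    then obtain p q where pq: "?C (Suc n) p" "?C n q" by blast
    have "?C (Suc (Suc n)) (2 * L * p - q)"
      using pq step[of p n q] by (simp only: cos_step) simp
    then show ?case using pq by blast
  qed
  have S: "(\<exists>T. ?S n T) \<and> (\<exists>T. ?S (Suc n) T)"
  proof (induction n)
    case 0
    have "?S 0 1" by simp
    moreover have "?S (Suc 0) (2 * L)"
      using assms by (simp only: sin_step) (simp add: numeral_poly)
    ultimately show ?case by blast
  next
    case (Suc n)
    then obtain p q where pq: "?S (Suc n) p" "?S n q" by blast
    have "?S (Suc (Suc n)) (2 * L * p - q)"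
      using pq step[of p n q] by (simp only: sin_step[of "Suc n"]) (simp add: algebra_simps)
    then show ?case using pq by blast
  qed
  show "\<exists>T. ?C n T" using C by blast
  show "\<exists>U. ?S n U" using S by blast
qed

text \<open>The addition theorems rotate each coefficient pair; cosines of multiples then feed
  \<open>A\<close> and sines feed \<open>B\<close>. Degrees are bounded through vanishing
  coefficients, so that for \<open>N = 0\<close> the bound on \<open>B\<close> says
  \<open>B = 0\<close>.\<close>

lemma trig_poly_shift:
  fixes L :: "real poly" and a b :: "nat \<Rightarrow> real"
  assumes f: "\<And>\<theta>. f \<theta> = a0 + (\<Sum>n=1..N. a n * cos (real n * \<theta>) + b n * sin (real n * \<theta>))"
    and L: "degree L \<le> 1"
  shows "\<exists>A B. (\<forall>k\<ge>Suc N. coeff A k = 0) \<and> (\<forall>k\<ge>N. coeff B k = 0) \<and>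
           (\<forall>x y. cos x = poly L y \<longrightarrow> f (x + d) = poly A y + sin x * poly B y)"
proof -
  from cos_sin_multiple_poly(1)[OF L] obtain T where T: "\<And>n. degree (T n) \<le> n"
      "\<And>n x y. cos x = poly L y \<Longrightarrow> cos (real n * x) = poly (T n) y" by metis
  from cos_sin_multiple_poly(2)[OF L] obtain U where U: "\<And>n. degree (U n) \<le> n"
      "\<And>n x y. cos x = poly L y \<Longrightarrow> sin (real (Suc n) * x) = sin x * poly (U n) y" by metis
  define A where "A = [:a0:] +
    (\<Sum>n=1..N. smult (a n * cos (real n * d) + b n * sin (real n * d)) (T n))"
  define B where "B =
    (\<Sum>n=1..N. smult (b n * cos (real n * d) - a n * sin (real n * d)) (U (n - 1)))"
  have "coeff A k = 0" if "k \<ge> Suc N" for k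
  proof -
    have "coeff (T n) k = 0" if "n \<in> {1..N}" for n
      using T(1)[of n] that \<open>k \<ge> Suc N\<close> by (intro coeff_eq_0) auto
    then show ?thesis using that by (auto simp: A_def coeff_sum coeff_pCons split: nat.splits)
  qed
  moreover have "coeff B k = 0" if "k \<ge> N" for k
  proof -
    have "coeff (U (n - 1)) k = 0" if "n \<in> {1..N}" for n
      using U(1)[of "n - 1"] that \<open>k \<ge> N\<close> by (intro coeff_eq_0) auto
    then show ?thesis by (simp add: B_def coeff_sum)
  qed
  moreover have "f (x + d) = poly A y + sin x * poly B y" if "cos x = poly L y" for x y
  proof -
    have "a n * cos (real n * (x + d)) + b n * sin (real n * (x + d)) =
        (a n * cos (real n * d) + b n * sin (real n * d)) * poly (T n) y +
        sin x * ((b n * cos (real n * d) - a n * sin (real n * d)) * poly (U (n - 1)) y)"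
      if "n \<in> {1..N}" for n
    proof -
      have "cos (real n * x) = poly (T n) y" "sin (real n * x) = sin x * poly (U (n - 1)) y"
        using T(2)[OF \<open>cos x = poly L y\<close>, of n] U(2)[OF \<open>cos x = poly L y\<close>, of "n - 1"] that
        by auto
      then show ?thesis by (simp add: distrib_left cos_add sin_add) (simp add: algebra_simps)
    qed
    then show ?thesis
      by (simp add: f A_def B_def poly_sum sum_distrib_left sum.distrib)
  qed
  ultimately show ?thesis by blast
qed

section \<open>Expansions on a single arc\<close>

lemma sum_even_odd:
  "(\<Sum>r<2 * n + 1. F r) = (\<Sum>k<Suc n. F (2 * k)) + (\<Sum>k<n. F (2 * k + 1) :: real)"
  by (induction n) (simp_all add: algebra_simps)

lemma arc_tau_gt_1: "-1 < h \<Longrightarrow> h < 1 \<Longrightarrow> arc_tau h > 1"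
  by (simp add: arc_tau_def field_simps)

lemma arc_sigma_linear: "h \<noteq> 1 \<Longrightarrow> cos x = poly [:1, h - 1:] (arc_sigma h x)"
  by (simp add: arc_sigma_def)

lemma arc_expansion_zero:
  fixes a b :: "nat \<Rightarrow> real"
  assumes f: "\<And>\<theta>. f \<theta> = a0 + (\<Sum>n=1..N. a n * cos (real n * \<theta>) + b n * sin (real n * \<theta>))"
    and h: "-1 < h" "h < 1"
  shows "\<exists>w. \<forall>x. f (x + d) = (\<Sum>r<2 * N + 1.
      (if even r then arc_p 0 h (r div 2) x else arc_q 0 h ((r + 1) div 2) x) * w r)"
proof -
  note expand = semiclassical_jacobi_expansion[OF arc_tau_gt_1[OF h]]
  have "degree [:1, h - 1:] \<le> 1" by simp
  from trig_poly_shift[OF f this, of d] obtain A B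
    where A: "\<forall>k\<ge>Suc N. coeff A k = 0" and B: "\<forall>k\<ge>N. coeff B k = 0"
      and AB: "\<And>x y. cos x = poly [:1, h - 1:] y \<Longrightarrow> f (x + d) = poly A y + sin x * poly B y"
    by blast
  have "- 1 < (-1/2 :: real)" "0 \<le> (0 :: real)" by simp_all
  from expand[OF this A, of "-1/2"] obtain u where
    u: "A = (\<Sum>k<Suc N. smult (u k)
      ((THE P. is_semiclassical_jacobi (arc_tau h) (-1/2) 0 (-1/2) P) k))" by blast
  have "- 1 < (1/2 :: real)" "0 \<le> (0 :: real)" by simp_all
  from expand[OF this B, of "1/2"] obtain v where
    v: "B = (\<Sum>k<N. smult (v k)
      ((THE P. is_semiclassical_jacobi (arc_tau h) (1/2) 0 (1/2) P) k))" by blast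
  \<comment> \<open>The columns interleave \<open>A\<close> and \<open>B\<close>. For
    \<open>r = 2 * k + 1\<close> the function is \<open>arc_q\<close> of index \<open>k + 1\<close>,
    whose polynomial has index \<open>k\<close>, so both parities use
    \<open>r div 2\<close>.\<close>
  define w where "w r = (if even r then u (r div 2) else v (r div 2))" for r
  have "f (x + d) = (\<Sum>r<2 * N + 1.
      (if even r then arc_p 0 h (r div 2) x else arc_q 0 h ((r + 1) div 2) x) * w r)" for x
    using AB[OF arc_sigma_linear[of h x]] h(2)
    by (subst sum_even_odd)
      (simp add: u v w_def arc_p_def arc_q_def semiclassical_jacobi_def poly_sum
        sum_distrib_left mult_ac del: sum.lessThan_Suc)
  then show ?thesis by blast
qed

text \<open>Synthetic division at 1, with the sign moved into the quotient to produce the factor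
  \<open>1 - X\<close>.\<close>

lemma poly_split_at_one:
  fixes p :: "'a :: idom poly"
  assumes "\<forall>k\<ge>n. coeff p k = 0"
  shows "\<exists>c q. p = [:c:] + [:1, -1:] * q \<and> (\<forall>k\<ge>n - 1. coeff q k = 0)"
proof (intro exI conjI allI impI)
  show "p = [:poly p 1:] + [:1, -1:] * (- synthetic_div p 1)"
    using synthetic_div_correct'[of 1 p] by (simp add: algebra_simps)
  fix k assume k: "k \<ge> n - 1"
  show "coeff (- synthetic_div p 1) k = 0"
  \<comment> \<open>A constant \<open>p\<close> needs the quotient to be zero itself: having degree
    0 would not make its coefficient at \<open>k = 0\<close> vanish.\<close>
  proof (cases "degree p = 0")
    case True
    then have "synthetic_div p 1 = 0" by (simp add: synthetic_div_eq_0_iff)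
    then show ?thesis by simp
  next
    case False
    have "degree p < n" using assms False
      by (metis leading_coeff_0_iff degree_0 not_le)
    then have "degree (synthetic_div p 1) < k"
      using False k by (simp add: degree_synthetic_div)
    then show ?thesis by (simp add: coeff_eq_0)
  qed
qed

text \<open>The blocks after the hats, in column order \<open>p_1, q_2, p_2, q_3, ...\<close>. The
  omitted \<open>p_0 = 1\<close> and \<open>q_1 = sin\<close> are the members without the factor
  \<open>1 - sigma\<close>; the hats replace them.\<close>

definition arc_bubble :: "real \<Rightarrow> nat \<Rightarrow> real \<Rightarrow> real" where
  "arc_bubble h r x =
     (if even r then arc_p (-1) h (r div 2 + 1) x else arc_q (-1) h (r div 2 + 2) x)"

lemma arc_bubble_eq_0:
  assumes "h \<noteq> 1" "cos x = h"
  shows "arc_bubble h r x = 0"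
  using assms by (simp add: arc_bubble_def arc_p_def arc_q_def semiclassical_jacobi_def arc_sigma_def)

lemma arc_expansion_minus_one:
  fixes a b :: "nat \<Rightarrow> real"
  assumes f: "\<And>\<theta>. f \<theta> = a0 + (\<Sum>n=1..N. a n * cos (real n * \<theta>) + b n * sin (real n * \<theta>))"
    and phi: "0 < \<phi>" "\<phi> < pi"
  shows "\<exists>w. \<forall>x. f (x + d) = f (d - \<phi>) * ((1 - sin x / sin \<phi>) / 2)
      + f (d + \<phi>) * ((1 + sin x / sin \<phi>) / 2) + (\<Sum>r<2 * N - 1. arc_bubble (cos \<phi>) r x * w r)"
proof -
  define h where "h = cos \<phi>"
  have h: "-1 < h" "h < 1"
    using phi cos_monotone_0_pi[of \<phi> pi] cos_monotone_0_pi[of 0 \<phi>] by (auto simp: h_def)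
  have sin: "sin \<phi> \<noteq> 0" using sin_gt_zero[OF phi] by simp
  note expand = semiclassical_jacobi_expansion[OF arc_tau_gt_1[OF h]]
  have "degree [:1, h - 1:] \<le> 1" by simp
  from trig_poly_shift[OF f this, of d] obtain A B
    where A: "\<forall>k\<ge>Suc N. coeff A k = 0" and B: "\<forall>k\<ge>N. coeff B k = 0"
      and AB: "\<And>x y. cos x = poly [:1, h - 1:] y \<Longrightarrow> f (x + d) = poly A y + sin x * poly B y"
    by blast
  from poly_split_at_one[OF A, simplified diff_Suc_1] obtain \<alpha> C where C: "A = [:\<alpha>:] + [:1, -1:] * C"
    "\<forall>k\<ge>N. coeff C k = 0" by blast
  from poly_split_at_one[OF B] obtain \<beta> D where D: "B = [:\<beta>:] + [:1, -1:] * D"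
    "\<forall>k\<ge>N - 1. coeff D k = 0" by blast
  have "- 1 < (-1/2 :: real)" "0 \<le> (1 :: real)" by simp_all
  from expand[OF this C(2), of "-1/2"] obtain u where
    u: "C = (\<Sum>k<N. smult (u k)
      ((THE P. is_semiclassical_jacobi (arc_tau h) (-1/2) 1 (-1/2) P) k))" by blast
  have "- 1 < (1/2 :: real)" "0 \<le> (1 :: real)" by simp_all
  from expand[OF this D(2), of "1/2"] obtain v where
    v: "D = (\<Sum>k<N - 1. smult (v k)
      ((THE P. is_semiclassical_jacobi (arc_tau h) (1/2) 1 (1/2) P) k))" by blast
  define w where "w r = (if even r then u (r div 2) else v (r div 2))" for r
  let ?P = "THE P. is_semiclassical_jacobi (arc_tau h) (-1/2) 1 (-1/2) P"
  let ?Q = "THE P. is_semiclassical_jacobi (arc_tau h) (1/2) 1 (1/2) P"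
  have bubbles: "(1 - y) * poly C y + sin x * ((1 - y) * poly D y) =
      (\<Sum>r<2 * N - 1. arc_bubble h r x * w r)" if y: "y = arc_sigma h x" for x y
  \<comment> \<open>For \<open>N = 0\<close> the bound \<open>2 * N - 1\<close> truncates to 0 and
    there are no bubbles. Otherwise it is odd and leaves \<open>N\<close> cosine and
    \<open>N - 1\<close> sine members.\<close>
  proof (cases N)
    case 0
    then show ?thesis by (simp add: u v)
  next
    case (Suc n)
    have "arc_bubble h (2 * k) x = (1 - y) * poly (?P k) y"
      "arc_bubble h (2 * k + 1) x = sin x * ((1 - y) * poly (?Q k) y)" for k
      by (simp_all add: arc_bubble_def arc_p_def arc_q_def semiclassical_jacobi_def y algebra_simps)
    moreover have "w (2 * k) = u k" "w (2 * k + 1) = v k" for k by (simp_all add: w_def)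
    moreover have "2 * N - 1 = 2 * n + 1" using Suc by simp
    ultimately have "(\<Sum>r<2 * N - 1. arc_bubble h r x * w r) =
        (\<Sum>k<Suc n. (1 - y) * poly (?P k) y * u k) +
        (\<Sum>k<n. sin x * ((1 - y) * poly (?Q k) y) * v k)"
      by (simp only: sum_even_odd)
    then show ?thesis
      by (simp only: u v Suc poly_sum poly_smult sum_distrib_left diff_Suc_1 mult_ac)
  qed
  have split: "f (x + d) = \<alpha> + sin x * \<beta> + (\<Sum>r<2 * N - 1. arc_bubble h r x * w r)" for x
    using AB[OF arc_sigma_linear[of h x]] h(2) bubbles[OF refl, of x]
    by (simp add: C(1) D(1) algebra_simps)
  \<comment> \<open>Evaluation at the two ends removes all bubbles, so the end point values of
    \<open>f\<close> determine \<open>\<alpha>\<close> and \<open>\<beta>\<close>.\<close>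
  have "arc_bubble h r \<phi> = 0" "arc_bubble h r (- \<phi>) = 0" for r
    using h by (auto intro!: arc_bubble_eq_0 simp: h_def)
  then have "f (\<phi> + d) = \<alpha> + sin \<phi> * \<beta>" "f (- \<phi> + d) = \<alpha> - sin \<phi> * \<beta>"
    by (simp_all only: split) simp_all
  then have ends: "f (d + \<phi>) = \<alpha> + sin \<phi> * \<beta>" "f (d - \<phi>) = \<alpha> - sin \<phi> * \<beta>"
    by (simp_all add: add.commute)
  have "f (x + d) = f (d - \<phi>) * ((1 - sin x / sin \<phi>) / 2)
      + f (d + \<phi>) * ((1 + sin x / sin \<phi>) / 2) + (\<Sum>r<2 * N - 1. arc_bubble h r x * w r)" for x
  proof -
    have "\<alpha> + sin x * \<beta> = f (d - \<phi>) * ((1 - sin x / sin \<phi>) / 2)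
        + f (d + \<phi>) * ((1 + sin x / sin \<phi>) / 2)"
      unfolding ends using sin by (simp add: field_simps)
    then show ?thesis using split[of x] by simp
  qed
  then show ?thesis unfolding h_def by blast
qed

section \<open>The grid and the basis functions at a given point\<close>

locale arc_grid =
  fixes M :: nat and g :: "nat \<Rightarrow> real"
  assumes M: "M \<ge> 2"
    and grid_left: "g 1 = - pi"
    and grid_right: "g (M + 1) = pi"
    and grid_step: "\<And>i. i \<in> {1..M} \<Longrightarrow> g i < g (i + 1)"
begin

lemma grid_less: "1 \<le> i \<Longrightarrow> i < j \<Longrightarrow> j \<le> M + 1 \<Longrightarrow> g i < g j"
proof (induction j)
  case (Suc j)
  then have "g j < g (Suc j)" using grid_step[of j] by simp
  then show ?case using Suc by (cases "i = j") auto
qed simp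

lemma grid_le: "1 \<le> i \<Longrightarrow> i \<le> j \<Longrightarrow> j \<le> M + 1 \<Longrightarrow> g i \<le> g j"
  using grid_less[of i j] by (cases "i = j") auto

text \<open>Since \<open>M >= 2\<close>, every element misses one of the end points
  \<open>-pi\<close>, \<open>pi\<close> and is shorter than the full circle; this keeps
  \<open>sin (half_len g i)\<close> away from 0.\<close>

lemma half_len_bounds:
  assumes "i \<in> {1..M}"
  shows "0 < half_len g i" "half_len g i < pi"
proof -
  show "0 < half_len g i" using grid_step[OF assms] by (simp add: half_len_def)
  have "- pi \<le> g i" "g (i + 1) \<le> pi"
    using grid_le[of 1 i] grid_le[of "i + 1" "M + 1"] assms grid_left grid_right by auto
  moreover have "- pi < g i \<or> g (i + 1) < pi"
    using grid_less[of 1 i] grid_less[of "i + 1" "M + 1"] assms M grid_left grid_right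
    by (cases "i = 1") auto
  ultimately show "half_len g i < pi" by (auto simp: half_len_def)
qed

lemma sin_half_len: "i \<in> {1..M} \<Longrightarrow> sin (half_len g i) \<noteq> 0"
  using half_len_bounds[of i] sin_gt_zero[of "half_len g i"] by auto

lemma cos_half_len:
  assumes "i \<in> {1..M}"
  shows "-1 < cos (half_len g i)" "cos (half_len g i) < 1"
  using half_len_bounds[OF assms] cos_monotone_0_pi[of "half_len g i" pi]
    cos_monotone_0_pi[of 0 "half_len g i"] by auto

lemma centred_ends: "centred g i (g i) = - half_len g i" "centred g i (g (i + 1)) = half_len g i"
  by (simp_all add: centred_def half_len_def field_simps)

lemma locate:
  assumes "-pi \<le> t" "t < pi"
  obtains i where "i \<in> {1..M}" "g i \<le> t" "t < g (i + 1)"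
proof -
  define S where "S = {i \<in> {1..M}. g i \<le> t}"
  have S: "finite S" "1 \<in> S" using M assms grid_left by (auto simp: S_def)
  define i where "i = Max S"
  have "i \<in> S" unfolding i_def using S by (intro Max_in) auto
  moreover have "t < g (i + 1)"
  proof (rule ccontr)
    assume *: "\<not> t < g (i + 1)"
    then have "i \<noteq> M" using assms grid_right by auto
    then have "i + 1 \<in> S" using * \<open>i \<in> S\<close> by (auto simp: S_def)
    then have "i + 1 \<le> i" unfolding i_def using S by (intro Max_ge)
    then show False by simp
  qed
  ultimately show thesis using that by (auto simp: S_def)
qed

text \<open>Closed elements overlap at nodes. With \<open>i\<close> chosen by half-open intervals,
  the only other candidate is the left neighbour at its right end. No wrap-around case arises, as
  element \<open>M\<close> contains \<open>pi\<close> but not \<open>-pi\<close>.\<close>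

lemma elem_cases:
  assumes i: "i \<in> {1..M}" "g i \<le> t" "t < g (i + 1)" and k: "k \<in> {1..M}" "t \<in> elem g k"
  shows "k = i \<or> (k + 1 = i \<and> t = g i)"
proof (cases k i rule: linorder_cases)
  case greater
  then have "g (i + 1) \<le> g k" using grid_le[of "i + 1" k] i k by auto
  then show ?thesis using i k by (auto simp: elem_def)
next
  case less
  then have "g (k + 1) \<le> g i" using grid_le[of "k + 1" i] i k by auto
  moreover have "t \<le> g (k + 1)" using k by (auto simp: elem_def)
  ultimately have "t = g i" "\<not> g (k + 1) < g i" using i by auto
  then show ?thesis using grid_less[of "k + 1" i] less i k by force
qed simp

text \<open>The cyclic inverse of \<open>prev_elem\<close>: on element \<open>i\<close> the rising
  hat is the one numbered \<open>next_elem i\<close>, the falling one is numbered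
  \<open>i\<close>.\<close>

definition next_elem :: "nat \<Rightarrow> nat" where
  "next_elem i = (if i = M then 1 else i + 1)"

lemma hat_on_elem:
  assumes i: "i \<in> {1..M}" "g i \<le> t" "t < g (i + 1)" and j: "j \<in> {1..M}"
  defines "s \<equiv> sin (centred g i t) / sin (half_len g i)"
  shows "hat M g j t =
      (if j = next_elem i then (1 + s) / 2 else 0) + (if j = i then (1 - s) / 2 else 0)"
proof -
  have ti: "t \<in> elem g i" using i by (auto simp: elem_def)
  have prev: "prev_elem M j \<in> {1..M}" using j M by (auto simp: prev_elem_def)
  consider (nxt) "j = next_elem i" | (self) "j = i" "j \<noteq> next_elem i"
    | (other) "j \<noteq> i" "j \<noteq> next_elem i" by blast
  then show ?thesis
  proof cases
    case nxt
    then have "prev_elem M j = i" "j \<noteq> i"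
      using i M by (auto simp: prev_elem_def next_elem_def)
    then show ?thesis using nxt ti by (simp add: hat_def s_def)
  next
    case self
    show ?thesis
    proof (cases "t \<in> elem g (prev_elem M j)")
      case True
      \<comment> \<open>Here \<open>t\<close> is the node \<open>g i\<close>, and \<open>hat\<close>
        takes its branch for the previous element; both branches give 1 there.\<close>
      have "prev_elem M j \<noteq> i" using self i M by (auto simp: prev_elem_def)
      then have p: "prev_elem M j + 1 = i" "t = g i" using elem_cases[OF i prev True] by auto
      then have "centred g (prev_elem M j) t = half_len g (prev_elem M j)"
        using centred_ends(2)[of "prev_elem M j"] by simp
      moreover have "centred g i t = - half_len g i"
        using p(2) centred_ends(1) by simp
      ultimately have "hat M g j t = 1" "s = -1"
        using True sin_half_len[OF prev] sin_half_len[OF i(1)]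
        by (simp_all add: hat_def s_def)
      then show ?thesis using self by simp
    next
      case False
      then show ?thesis using self ti by (simp add: hat_def s_def)
    qed
  next
    case other
    have "t \<notin> elem g (prev_elem M j)"
    proof
      assume "t \<in> elem g (prev_elem M j)"
      then have "prev_elem M j = i \<or> prev_elem M j + 1 = i" using elem_cases[OF i prev] by auto
      then show False using other j i M
        by (auto simp: prev_elem_def next_elem_def split: if_splits)
    qed
    \<comment> \<open>If \<open>t\<close> still lies in element \<open>j\<close>, it is the right
      end of that element, where the falling hat has reached 0.\<close>
    moreover have "sin (centred g j t) / sin (half_len g j) = 1" if "t \<in> elem g j"
      using elem_cases[OF i j that] other sin_half_len[OF j] centred_ends(2)[of j] by auto
    ultimately show ?thesis using other by (cases "t \<in> elem g j") (simp_all add: hat_def)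
  qed
qed

text \<open>At a node the left neighbour also contributes, but only with an end point value, and
  bubbles vanish there. Hence the expansion for \<open>b = -1\<close> holds at nodes too.\<close>

lemma bubble_on_elem:
  assumes i: "i \<in> {1..M}" "g i \<le> t" "t < g (i + 1)" and j: "j \<in> {1..M}"
  shows "(if even r then pw_cos (-1) g (r div 2 + 1) j t else pw_sin (-1) g (r div 2 + 2) j t) =
      (if j = i then arc_bubble (cos (half_len g i)) r (centred g i t) else 0)"
proof (cases "j = i")
  case True
  then show ?thesis using i by (simp add: pw_cos_def pw_sin_def arc_bubble_def elem_def)
next
  case False
  have "arc_bubble (cos (half_len g j)) r (centred g j t) = 0" if "t \<in> elem g j"
  proof (rule arc_bubble_eq_0)
    show "cos (centred g j t) = cos (half_len g j)"
      using elem_cases[OF i j that] False centred_ends(2)[of j] by auto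
    show "cos (half_len g j) \<noteq> 1" using cos_half_len[OF j] by simp
  qed
  then show ?thesis using False by (auto simp: pw_cos_def pw_sin_def arc_bubble_def)
qed

end

section \<open>Sums over columns and periodic extension\<close>

lemma blockwise_sums:
  fixes B :: "nat \<Rightarrow> real"
  assumes B: "\<And>k. B k = G (k div M) (k mod M + 1)" and "M > 0"
  shows "(\<lambda>k. B k * zero_padded (map (\<lambda>k. W (k div M) (k mod M + 1)) [0..<M * R]) k)
    sums (\<Sum>r<R. \<Sum>i=1..M. G r i * W r i)"
proof -
  let ?h = "\<lambda>k. B k * zero_padded (map (\<lambda>k. W (k div M) (k mod M + 1)) [0..<M * R]) k"
  \<comment> \<open>The zero padding turns the series into a finite sum, which is then cut into
    \<open>R\<close> runs of \<open>M\<close> consecutive columns.\<close>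
  have "?h sums (\<Sum>k<R * M. ?h k)"
    by (rule sums_finite) (auto simp: zero_padded_def mult.commute)
  also have "(\<Sum>k<R * M. ?h k) = (\<Sum>r<R. \<Sum>k = r * M..<r * M + M. ?h k)"
    by (rule sum.nat_group[symmetric])
  also have "\<dots> = (\<Sum>r<R. \<Sum>i=1..M. G r i * W r i)"
  proof (rule sum.cong[OF refl])
    fix r assume "r \<in> {..<R}"
    then have le: "r * M + M \<le> M * R" by (metis Suc_leI add.commute lessThan_iff mult.commute mult_Suc mult_le_mono2)
    show "(\<Sum>k = r * M..<r * M + M. ?h k) = (\<Sum>i=1..M. G r i * W r i)"
    proof (rule sum.reindex_bij_witness[where i = "\<lambda>i. r * M + (i - 1)" and j = "\<lambda>k. k - r * M + 1"])
      fix k assume k: "k \<in> {r * M..<r * M + M}"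
      then obtain l where l: "k = r * M + l" "l < M" by (metis atLeastLessThan_iff le_Suc_ex nat_add_left_cancel_less)
      then show "G r (k - r * M + 1) * W r (k - r * M + 1) = ?h k"
        using le by (simp add: zero_padded_def B)
    qed auto
  qed
  finally show ?thesis .
qed

text \<open>One reduced point \<open>t\<close> serves all functions \<open>u\<close> at once, so
  every column is evaluated at the same place.\<close>

lemma periodic_ext_reduced:
  obtains l :: int and t :: real where "-pi \<le> t" "t < pi" "\<theta> = t + 2 * pi * of_int l"
    "\<And>u. periodic_ext u \<theta> = u t"
proof -
  define l where "l = \<lfloor>(\<theta> + pi) / (2 * pi)\<rfloor>"
  have "of_int l \<le> (\<theta> + pi) / (2 * pi)" "(\<theta> + pi) / (2 * pi) < of_int l + 1"
    by (simp_all add: l_def)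
  then have "-pi \<le> \<theta> - 2 * pi * of_int l" "\<theta> - 2 * pi * of_int l < pi"
    by (simp_all add: field_simps)
  then show thesis using that[of "\<theta> - 2 * pi * of_int l" l] by (simp add: periodic_ext_def l_def)
qed

lemma periodic_ext_shift:
  assumes "-pi \<le> t" "t < pi"
  shows "periodic_ext u (t + 2 * pi * of_int l) = u t"
proof -
  have "\<lfloor>(t + 2 * pi * of_int l + pi) / (2 * pi)\<rfloor> = l"
    using assms by (intro floor_unique) (simp_all add: field_simps)
  then show ?thesis by (simp add: periodic_ext_def)
qed

lemma trig_poly_periodic:
  fixes a b :: "nat \<Rightarrow> real"
  assumes f: "\<And>\<theta>. f \<theta> = a0 + (\<Sum>n=1..N. a n * cos (real n * \<theta>) + b n * sin (real n * \<theta>))"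
  shows "f (t + 2 * pi * of_int l) = f t"
proof -
  have "real n * (t + 2 * pi * of_int l) = real n * t + 2 * pi * of_int (int n * l)" for n
    by (simp add: algebra_simps)
  then show ?thesis unfolding f by (simp only: cos_add sin_add cos_int_2pin sin_int_2pin) simp
qed

section \<open>Assembly of the local expansions\<close>

theorem theorem3:
  fixes N M :: nat and a0 :: real and a b :: "nat \<Rightarrow> real"
    and f :: "real \<Rightarrow> real" and g :: "nat \<Rightarrow> real"
  assumes f: "\<And>\<theta>. f \<theta> = a0 + (\<Sum>n=1..N. a n * cos (real n * \<theta>) + b n * sin (real n * \<theta>))"
    and M: "M \<ge> 2"
    and grid_left: "g 1 = - pi"
    and grid_right: "g (M + 1) = pi"
    and grid_mono: "\<And>i. i \<in> {1..M} \<Longrightarrow> g i < g (i + 1)"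
  shows "(\<exists>f0 :: real list. length f0 = M * (2 * N + 1) \<and>
            (\<forall>i\<in>{1..M}. \<forall>\<theta>\<in>interior (elem g i). \<forall>l::int.
               (\<lambda>k. basis_zero M g k (\<theta> + 2 * pi * of_int l) * zero_padded f0 k)
                 sums f (\<theta> + 2 * pi * of_int l)))
       \<and> (\<exists>f0 :: real list. length f0 = M * max (2 * N) 1 \<and>
            (\<forall>\<theta>. (\<lambda>k. basis_minus_one M g k \<theta> * zero_padded f0 k) sums f \<theta>))"
proof -
  interpret arc_grid M g
    by unfold_locales (use M grid_left grid_right grid_mono in auto)
  have periodic: "f (t + 2 * pi * of_int l) = f t" for t l
    by (rule trig_poly_periodic[OF f])
  define d where "d i = (g i + g (i + 1)) / 2" for i
  have d: "centred g i t + d i = t" for t i by (simp add: centred_def d_def)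
  show ?thesis
  proof (intro conjI)
    have "\<forall>i\<in>{1..M}. \<exists>w. \<forall>x. f (x + d i) = (\<Sum>r<2 * N + 1.
        (if even r then arc_p 0 (cos (half_len g i)) (r div 2) x
         else arc_q 0 (cos (half_len g i)) ((r + 1) div 2) x) * w r)"
      by (intro ballI arc_expansion_zero[OF f] cos_half_len)
    from bchoice[OF this] obtain w where w: "f (x + d i) = (\<Sum>r<2 * N + 1.
        (if even r then arc_p 0 (cos (half_len g i)) (r div 2) x
         else arc_q 0 (cos (half_len g i)) ((r + 1) div 2) x) * w i r)" if "i \<in> {1..M}" for i x
      by blast
    define f0 where "f0 = map (\<lambda>k. w (k mod M + 1) (k div M)) [0..<M * (2 * N + 1)]"
    have "(\<lambda>k. basis_zero M g k (t + 2 * pi * of_int l) * zero_padded f0 k)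
        sums f (t + 2 * pi * of_int l)"
      if i: "i \<in> {1..M}" and t: "t \<in> interior (elem g i)" for i t l
    proof -
      have t': "g i < t" "t < g (i + 1)"
        using t by (auto simp: elem_def interior_atLeastAtMost_real)
      have "-pi \<le> g i" "g (i + 1) \<le> pi"
        using grid_le[of 1 i] grid_le[of "i + 1" "M + 1"] i grid_left grid_right by auto
      then have range: "-pi \<le> t" "t < pi" using t' by auto
      define G where "G r j = (if even r then pw_cos 0 g (r div 2) j t
        else pw_sin 0 g ((r + 1) div 2) j t)" for r j
      have "basis_zero M g k (t + 2 * pi * of_int l) = G (k div M) (k mod M + 1)" for k
        by (simp add: basis_zero_def Let_def periodic_ext_shift[OF range] G_def)
      from blockwise_sums[where W = "\<lambda>r i. w i r" and R = "2 * N + 1" and G = G, OF this] M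
      have "(\<lambda>k. basis_zero M g k (t + 2 * pi * of_int l) * zero_padded f0 k)
          sums (\<Sum>r<2 * N + 1. \<Sum>j=1..M. G r j * w j r)" by (simp add: f0_def)
      moreover have "(\<Sum>j=1..M. G r j * w j r) =
        (if even r then arc_p 0 (cos (half_len g i)) (r div 2) (centred g i t)
         else arc_q 0 (cos (half_len g i)) ((r + 1) div 2) (centred g i t)) * w i r" for r
      proof -
        \<comment> \<open>An interior point lies in no other closed element, so each block
          contributes a single column.\<close>
        have "t \<notin> elem g j" if "j \<in> {1..M}" "j \<noteq> i" for j
          using elem_cases[OF i less_imp_le[OF t'(1)] t'(2) that(1)] that(2) t' by auto
        then have "(\<Sum>j=1..M. G r j * w j r) = (\<Sum>j=1..M. if j = i then G r i * w i r else 0)"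
          by (intro sum.cong) (auto simp: G_def pw_cos_def pw_sin_def)
        also have "\<dots> = G r i * w i r" using i by simp
        finally show ?thesis using t' by (simp add: G_def pw_cos_def pw_sin_def elem_def)
      qed
      ultimately show ?thesis using w[OF i, of "centred g i t"] by (simp only: d periodic)
    qed
    then show "\<exists>f0 :: real list. length f0 = M * (2 * N + 1) \<and>
            (\<forall>i\<in>{1..M}. \<forall>\<theta>\<in>interior (elem g i). \<forall>l::int.
               (\<lambda>k. basis_zero M g k (\<theta> + 2 * pi * of_int l) * zero_padded f0 k)
                 sums f (\<theta> + 2 * pi * of_int l))"
      by (intro exI[of _ f0]) (simp add: f0_def)
  next
    have ends: "d i - half_len g i = g i" "d i + half_len g i = g (i + 1)" for i
      by (simp_all add: d_def half_len_def field_simps)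
    have "\<forall>i\<in>{1..M}. \<exists>w. \<forall>x. f (x + d i) =
        f (d i - half_len g i) * ((1 - sin x / sin (half_len g i)) / 2)
        + f (d i + half_len g i) * ((1 + sin x / sin (half_len g i)) / 2)
        + (\<Sum>r<2 * N - 1. arc_bubble (cos (half_len g i)) r x * w r)"
      by (intro ballI arc_expansion_minus_one[OF f] half_len_bounds)
    from bchoice[OF this[unfolded ends]] obtain w where w: "f (x + d i) =
        f (g i) * ((1 - sin x / sin (half_len g i)) / 2)
        + f (g (i + 1)) * ((1 + sin x / sin (half_len g i)) / 2)
        + (\<Sum>r<2 * N - 1. arc_bubble (cos (half_len g i)) r x * w i r)" if "i \<in> {1..M}" for i x
      by blast
    \<comment> \<open>The hat coefficients are the nodal values of \<open>f\<close>; block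
      \<open>Suc r\<close> takes the bubble coefficients of index \<open>r\<close>.\<close>
    define W where "W r i = (case r of 0 \<Rightarrow> f (g i) | Suc r \<Rightarrow> w i r)" for r i
    define f0 where "f0 = map (\<lambda>k. W (k div M) (k mod M + 1)) [0..<M * Suc (2 * N - 1)]"
    have "(\<lambda>k. basis_minus_one M g k \<theta> * zero_padded f0 k) sums f \<theta>" for \<theta>
    proof -
      obtain l t where t: "-pi \<le> t" "t < pi" "\<theta> = t + 2 * pi * of_int l"
        and ext: "\<And>u. periodic_ext u \<theta> = u t" using periodic_ext_reduced[of \<theta>] by blast
      obtain i where i: "i \<in> {1..M}" "g i \<le> t" "t < g (i + 1)" using locate t by blast
      define s where "s = sin (centred g i t) / sin (half_len g i)"
      define G where "G r j = (case r of 0 \<Rightarrow> hat M g j t | Suc r \<Rightarrow>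
        if even r then pw_cos (-1) g (r div 2 + 1) j t else pw_sin (-1) g (r div 2 + 2) j t)" for r j
      have bubbles: "(\<Sum>j=1..M. G (Suc r) j * W (Suc r) j) =
          arc_bubble (cos (half_len g i)) r (centred g i t) * w i r" for r
      proof -
        have "(\<Sum>j=1..M. G (Suc r) j * W (Suc r) j) =
            (\<Sum>j=1..M. if j = i
              then arc_bubble (cos (half_len g i)) r (centred g i t) * w i r else 0)"
          using bubble_on_elem[OF i, of _ r] by (intro sum.cong) (simp_all add: G_def W_def)
        then show ?thesis using i by simp
      qed
      \<comment> \<open>The block number is one more than the bubble index, which swaps the
        parities: block \<open>Suc r\<close> is a cosine block exactly for even
        \<open>r\<close>.\<close>
      have "basis_minus_one M g k \<theta> = G (k div M) (k mod M + 1)" for k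
        by (auto simp: basis_minus_one_def Let_def ext G_def split: nat.split)
      from blockwise_sums[where W = W and R = "Suc (2 * N - 1)" and G = G, OF this] M
      have "(\<lambda>k. basis_minus_one M g k \<theta> * zero_padded f0 k)
          sums (\<Sum>r<Suc (2 * N - 1). \<Sum>j=1..M. G r j * W r j)" by (simp add: f0_def del: sum.lessThan_Suc)
      also have "(\<Sum>r<Suc (2 * N - 1). \<Sum>j=1..M. G r j * W r j) =
          (\<Sum>j=1..M. G 0 j * W 0 j) + (\<Sum>r<2 * N - 1. \<Sum>j=1..M. G (Suc r) j * W (Suc r) j)"
        by (rule sum.lessThan_Suc_shift)
      also have "(\<Sum>j=1..M. G 0 j * W 0 j) =
          f (g i) * ((1 - s) / 2) + f (g (i + 1)) * ((1 + s) / 2)"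
      proof -
        have "(\<Sum>j=1..M. G 0 j * W 0 j) =
            (\<Sum>j=1..M. (if j = next_elem i then (1 + s) / 2 * f (g j) else 0)
              + (if j = i then (1 - s) / 2 * f (g j) else 0))"
          using hat_on_elem[OF i] by (intro sum.cong) (auto simp: G_def W_def s_def algebra_simps)
        also have "\<dots> = (1 + s) / 2 * f (g (next_elem i)) + (1 - s) / 2 * f (g i)"
          using i M by (simp add: sum.distrib next_elem_def)
        \<comment> \<open>For \<open>i = M\<close> the next hat sits at \<open>-pi\<close> while the
          right end is \<open>pi\<close>; periodicity of \<open>f\<close> lets one coefficient serve
          both.\<close>
        also have "f (g (next_elem i)) = f (g (i + 1))"
          using periodic[of "-pi" 1] grid_left grid_right by (auto simp: next_elem_def)
        finally show ?thesis by (simp add: mult.commute add.commute)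
      qed
      finally show ?thesis
        using w[OF i(1), of "centred g i t"] by (simp only: d bubbles t(3) periodic s_def)
    qed
    moreover have "length f0 = M * max (2 * N) 1"
    proof -
      \<comment> \<open>Truncated subtraction accounts for the maximum: for \<open>N = 0\<close>
        only the hat block remains.\<close>
      have "Suc (2 * N - 1) = max (2 * N) 1" by auto
      then show ?thesis by (simp only: f0_def length_map length_upt diff_zero)
    qed
    ultimately show "\<exists>f0 :: real list. length f0 = M * max (2 * N) 1 \<and>
            (\<forall>\<theta>. (\<lambda>k. basis_minus_one M g k \<theta> * zero_padded f0 k) sums f \<theta>)"
      by blast
  qed
qed

end
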